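(* Let $Z_t$ be the process defined by $Z_t=\Phi_{U_t}\big(Z_{t-1}+\gamma_t(Z_{t-1})[R_t(Z_{t-1})+\varepsilon_t(Z_{t-1})]\big)$, $t=1,2,\dots$, in the setting described in the context, and write $\Delta_t=Z_t-z^0$. Suppose that (E1) $Z_t=Z_{t-1}+\gamma_t(Z_{t-1})[R_t(Z_{t-1})+\varepsilon_t(Z_{t-1})]$ eventually. Suppose also that there exists a sequence of invertible random $m\times m$ matrices $A_t$ such that (E2) $A_t^{-1}\to 0$ and $A_t\gamma_t(z^0)A_t\to\eta$ in probability as $t\to\infty$, where $\eta$ is a ($P$-a.s.) finite matrix; (E3) $\lim_{t\to\infty}A_t^{-1}\sum_{s=1}^t\big[\Delta\gamma_s^{-1}(z^0)\Delta_{s-1}+\tilde R_s(z^0+\Delta_{s-1})\big]=0$ in probability, where $\Delta\gamma_s^{-1}(z^0)=\gamma_s^{-1}(z^0)-\gamma_{s-1}^{-1}(z^0)$ and $\tilde R_s(z)=\gamma_s^{-1}(z^0)\gamma_s(z)R_s(z)$; (E4) $\lim_{t\to\infty}A_t^{-1}\sum_{s=1}^t\big[\tilde\varepsilon_s(z^0+\Delta_{s-1})-\varepsilon_s(z^0)\big]=0$ in probability, where $\tilde\varepsilon_s(z)=\gamma_s^{-1}(z^0)\gamma_s(z)\varepsilon_s(z)$. Then $A_t(Z_t-Z_t^* )\to 0$ in probability as $t\to\infty$, where $$Z_t^*=z^0+\gamma_t(z^0)\sum_{s=1}^t\varepsilon_s(z^0);$$ that is, $Z_t$ is locally asymptotically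 linear at $z^0$ with $\gamma_t=\gamma_t(z^0)$ and $\psi_t=\varepsilon_t(z^0)$.
   Context: Let $(\Omega,\mathcal F,(\mathcal F_t)_{t\ge0},P)$ be a stochastic basis satisfying the usual conditions. For each $t=1,2,\dots$ let $R_t(z)=R_t(z,\omega):\mathbb R^m\times\Omega\to\mathbb R^m$, $\varepsilon_t(z)=\varepsilon_t(z,\omega):\mathbb R^m\times\Omega\to\mathbb R^m$ and $\gamma_t(z)=\gamma_t(z,\omega):\mathbb R^m\times\Omega\to\mathbb R^{m\times m}$ be $(\mathcal B(\mathbb R^m)\times\mathcal F)$-measurable. For each $z\in\mathbb R^m$, $R_t(z)$ and $\gamma_t(z)$ are predictable ($\mathcal F_{t-1}$-measurable for each $t$), and $\varepsilon_t(z)$ is a martingale difference ($\mathcal F_t$-measurable with $E\{\varepsilon_t(z)\mid\mathcal F_{t-1}\}=0$). There is a non-random vector $z^0\in\mathbb R^m$ with $R_t(z^0)=0$ for all $t$. For a closed convex set $U\subset\mathbb R^m$, the truncation operator $\Phi_U:\mathbb R^m\to\mathbb R^m$ is $\Phi_U(z)=z$ if $z\in U$, and $\Phi_U(z)=z^*$ if $z\notin U$, where $z^*$ is the point of $U$ minimizing the distance to $z$. A random sequence of sets $U_t=U_t(\omega)$, $t=1,2,\dots$, is admissible for $z^0$ if: each $U_t(\omega)$ is a closed convex subset of $\mathbb R^m$; $\Phi_{U_t}(z)$ is $\mathcal F_t$-measurable for each $t$ and $z\in\mathbb R^m$; and $z^0\in U_t$ eventually. It is assumed that $Z_0\in\mathbb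 R^m$ is some starting value and that $U_t$ is admissible for $z^0$. With $\Psi_t(z)=R_t(z)+\varepsilon_t(z)$, it is assumed that $E\{\Psi_t(Z_{t-1})\mid\mathcal F_{t-1}\}=R_t(Z_{t-1})$ and $E\{\varepsilon_t^T(Z_{t-1})\varepsilon_t(Z_{t-1})\mid\mathcal F_{t-1}\}=\big[E\{\varepsilon_t^T(z)\varepsilon_t(z)\mid\mathcal F_{t-1}\}\big]_{z=Z_{t-1}}$, and that these conditional expectations are finite. The matrices $\gamma_t(z^0)$ are invertible for all $t\ge0$, $\gamma_0(z^0)$ being some given invertible matrix; $\gamma_t^{-1}(z^0)$ denotes the inverse of $\gamma_t(z^0)$. Conventions: relations between random variables hold $P$-a.s. unless specified otherwise. A property of a random sequence holds "eventually" if for every $\omega$ in a set of probability 1 it holds for all $t$ greater than some $t_0(\omega)<\infty$. Conditional expectations are integrals with respect to regular conditional probabilities. "Locally asymptotically linear at $z^0$ with $\gamma_t$ and $\psi_t$" is used here as the name for the property $A_t\big(Z_t-z^0-\gamma_t\sum_{s=1}^t\psi_s\big)\to0$ in probability. *)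

theory Defs
  imports "HOL-Probability.Probability"
begin

section \<open>Stochastic bases and conditional expectations\<close>

text \<open>
  Time is discrete (\<open>t = 0, 1, 2, \<dots>\<close>). Of the usual conditions only completeness
  (\<open>M\<close> complete and every \<open>M\<close>-null set in \<open>F 0\<close>) has content for a filtration indexed by the
  naturals; right-continuity says nothing there.
\<close>

locale stochastic_basis =
  prob_space M + complete_measure M + filtration "space M" F
  for M :: "'a measure" and F :: "nat \<Rightarrow> 'a measure" +
  assumes subalgebra_F: "\<And>t. subalgebra M (F t)"
    and null_sets_F: "null_sets M \<subseteq> sets (F 0)"

text \<open>
  \<open>K\<close> is a regular conditional probability given \<open>G\<close>. The measures \<open>K \<omega>\<close> live on a space
  \<open>M0\<close> whose completion is \<open>M\<close>. Since \<open>completion M = M\<close> for a complete \<open>M\<close>, the choice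
  \<open>M0 = M\<close> is allowed, but requiring it would be too restrictive: when \<open>M0\<close> is standard Borel, \<open>K\<close>
  always exists on \<open>M0\<close>, but in general it cannot be extended to all \<open>M\<close>-measurable sets.
  Integrals of \<open>M\<close>-measurable functions are therefore taken with respect to
  \<open>completion (K \<omega>)\<close>.
\<close>

definition regular_cond_prob ::
  "'a measure \<Rightarrow> 'a measure \<Rightarrow> 'a measure \<Rightarrow> ('a \<Rightarrow> 'a measure) \<Rightarrow> bool" where
  "regular_cond_prob M M0 G K \<longleftrightarrow>
     M = completion M0 \<and>
     K \<in> measurable G (prob_algebra M0) \<and>
     (\<forall>A\<in>sets M0. AE \<omega> in M. measure (K \<omega>) A = real_cond_exp M G (indicat_real A) \<omega>)"

text \<open>
  \<open>has_cond_exp M K X Y\<close>: the conditional expectation of \<open>X\<close> exists, is finite, and equals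
  \<open>Y\<close> almost surely. As is usual when conditional expectations are integrals with respect to a
  regular conditional probability, \<open>X\<close> need not be integrable with respect to \<open>M\<close>.
\<close>

definition has_cond_exp ::
  "'a measure \<Rightarrow> ('a \<Rightarrow> 'a measure) \<Rightarrow> ('a \<Rightarrow> 'b::{banach, second_countable_topology}) \<Rightarrow> ('a \<Rightarrow> 'b) \<Rightarrow> bool"
  where
  "has_cond_exp M K X Y \<longleftrightarrow> (AE \<omega> in M. has_bochner_integral (completion (K \<omega>)) X (Y \<omega>))"

definition cond_exp_nn :: "('a \<Rightarrow> 'a measure) \<Rightarrow> ('a \<Rightarrow> real) \<Rightarrow> 'a \<Rightarrow> ennreal" where
  "cond_exp_nn K X \<omega> = (\<integral>\<^sup>+ \<omega>'. ennreal (X \<omega>') \<partial>completion (K \<omega>))"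


section \<open>Convergence\<close>

definition eventually_as :: "'a measure \<Rightarrow> (nat \<Rightarrow> 'a \<Rightarrow> bool) \<Rightarrow> bool" where
  "eventually_as M P \<longleftrightarrow> (AE \<omega> in M. \<forall>\<^sub>F t in sequentially. P t \<omega>)"

definition tendsto_in_prob ::
  "'a measure \<Rightarrow> (nat \<Rightarrow> 'a \<Rightarrow> 'b::real_normed_vector) \<Rightarrow> ('a \<Rightarrow> 'b) \<Rightarrow> bool" where
  "tendsto_in_prob M X Y \<longleftrightarrow>
     (\<forall>e>0. (\<lambda>t. measure M {\<omega> \<in> space M. norm (X t \<omega> - Y \<omega>) > e}) \<longlonglongrightarrow> 0)"

definition locally_asymp_linear ::
  "'a measure \<Rightarrow> (nat \<Rightarrow> 'a \<Rightarrow> real^'m^'m) \<Rightarrow> (nat \<Rightarrow> 'a \<Rightarrow> real^'m) \<Rightarrow> real^'m \<Rightarrow>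
    (nat \<Rightarrow> 'a \<Rightarrow> real^'m^'m) \<Rightarrow> (nat \<Rightarrow> 'a \<Rightarrow> real^'m) \<Rightarrow> bool" where
  "locally_asymp_linear M A Z z0 \<gamma> \<psi> \<longleftrightarrow>
     tendsto_in_prob M
       (\<lambda>t \<omega>. A t \<omega> *v (Z t \<omega> - z0 - \<gamma> t \<omega> *v (\<Sum>s=1..t. \<psi> s \<omega>))) (\<lambda>_. 0)"


section \<open>Truncated stochastic approximation\<close>

definition truncation :: "(real^'m) set \<Rightarrow> real^'m \<Rightarrow> real^'m" where
  "truncation U z = (if z \<in> U then z else closest_point U z)"

text \<open>Nonemptiness of \<open>U t \<omega>\<close> is what makes the truncation well defined.\<close>

definition admissible ::
  "'a measure \<Rightarrow> (nat \<Rightarrow> 'a measure) \<Rightarrow> (nat \<Rightarrow> 'a \<Rightarrow> (real^'m) set) \<Rightarrow> real^'m \<Rightarrow> bool" where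
  "admissible M F U z0 \<longleftrightarrow>
     (\<forall>t\<ge>1. \<forall>\<omega>\<in>space M. closed (U t \<omega>) \<and> convex (U t \<omega>) \<and> U t \<omega> \<noteq> {}) \<and>
     (\<forall>t\<ge>1. \<forall>z. (\<lambda>\<omega>. truncation (U t \<omega>) z) \<in> borel_measurable (F t)) \<and>
     eventually_as M (\<lambda>t \<omega>. z0 \<in> U t \<omega>)"

primrec truncated_sa ::
  "(nat \<Rightarrow> 'a \<Rightarrow> (real^'m) set) \<Rightarrow> (nat \<Rightarrow> real^'m \<Rightarrow> 'a \<Rightarrow> real^'m^'m) \<Rightarrow>
    (nat \<Rightarrow> real^'m \<Rightarrow> 'a \<Rightarrow> real^'m) \<Rightarrow> (nat \<Rightarrow> real^'m \<Rightarrow> 'a \<Rightarrow> real^'m) \<Rightarrow>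
    ('a \<Rightarrow> real^'m) \<Rightarrow> nat \<Rightarrow> 'a \<Rightarrow> real^'m" where
  "truncated_sa U \<gamma> R \<epsilon> Zstart 0 = Zstart"
| "truncated_sa U \<gamma> R \<epsilon> Zstart (Suc t) =
     (\<lambda>\<omega>. let z = truncated_sa U \<gamma> R \<epsilon> Zstart t \<omega>
           in truncation (U (Suc t) \<omega>)
                (z + \<gamma> (Suc t) z \<omega> *v (R (Suc t) z \<omega> + \<epsilon> (Suc t) z \<omega>)))"

text \<open>
  \<open>K t\<close> is a regular conditional probability given \<open>F t\<close>. At \<open>t = 0\<close> only \<open>\<gamma> 0 z0\<close> is
  meaningful among the values of \<open>\<gamma>\<close>, \<open>R\<close>, \<open>\<epsilon>\<close> and \<open>U\<close>. The starting value and
  \<open>\<gamma> 0 z0\<close> may be any \<open>F 0\<close>-measurable variables, constants included.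
\<close>

locale truncated_sa_setting =
  stochastic_basis M F
  for M :: "'a measure" and F :: "nat \<Rightarrow> 'a measure" +
  fixes M0 :: "'a measure"
    and K :: "nat \<Rightarrow> 'a \<Rightarrow> 'a measure"
    and R :: "nat \<Rightarrow> real^'m \<Rightarrow> 'a \<Rightarrow> real^'m"
    and \<epsilon> :: "nat \<Rightarrow> real^'m \<Rightarrow> 'a \<Rightarrow> real^'m"
    and \<gamma> :: "nat \<Rightarrow> real^'m \<Rightarrow> 'a \<Rightarrow> real^'m^'m"
    and U :: "nat \<Rightarrow> 'a \<Rightarrow> (real^'m) set"
    and z0 :: "real^'m"
    and Zstart :: "'a \<Rightarrow> real^'m"
    and Z :: "nat \<Rightarrow> 'a \<Rightarrow> real^'m"
  assumes rcp: "\<And>t. regular_cond_prob M M0 (F t) (K t)"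
    and R_joint: "\<And>t. t \<ge> 1 \<Longrightarrow> (\<lambda>(z, \<omega>). R t z \<omega>) \<in> borel_measurable (borel \<Otimes>\<^sub>M M)"
    and \<epsilon>_joint: "\<And>t. t \<ge> 1 \<Longrightarrow> (\<lambda>(z, \<omega>). \<epsilon> t z \<omega>) \<in> borel_measurable (borel \<Otimes>\<^sub>M M)"
    and \<gamma>_joint: "\<And>t. t \<ge> 1 \<Longrightarrow> (\<lambda>(z, \<omega>). \<gamma> t z \<omega>) \<in> borel_measurable (borel \<Otimes>\<^sub>M M)"
    and R_predictable: "\<And>t z. t \<ge> 1 \<Longrightarrow> R t z \<in> borel_measurable (F (t - 1))"
    and \<gamma>_predictable: "\<And>t z. t \<ge> 1 \<Longrightarrow> \<gamma> t z \<in> borel_measurable (F (t - 1))"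
    and \<epsilon>_adapted: "\<And>t z. t \<ge> 1 \<Longrightarrow> \<epsilon> t z \<in> borel_measurable (F t)"
    and \<epsilon>_mart_diff: "\<And>t z. t \<ge> 1 \<Longrightarrow> has_cond_exp M (K (t - 1)) (\<epsilon> t z) (\<lambda>_. 0)"
    and R_root: "\<And>t. t \<ge> 1 \<Longrightarrow> AE \<omega> in M. R t z0 \<omega> = 0"
    and admissible_U: "admissible M F U z0"
    and Zstart: "Zstart \<in> borel_measurable (F 0)"
    and Z_def: "Z = truncated_sa U \<gamma> R \<epsilon> Zstart"
    and \<Psi>_cond_exp:
      "\<And>t. t \<ge> 1 \<Longrightarrow>
        has_cond_exp M (K (t - 1))
          (\<lambda>\<omega>. R t (Z (t - 1) \<omega>) \<omega> + \<epsilon> t (Z (t - 1) \<omega>) \<omega>)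
          (\<lambda>\<omega>. R t (Z (t - 1) \<omega>) \<omega>)"
    and \<epsilon>_square_cond_exp:
      "\<And>t. t \<ge> 1 \<Longrightarrow> AE \<omega> in M.
        cond_exp_nn (K (t - 1)) (\<lambda>\<omega>'. \<epsilon> t (Z (t - 1) \<omega>') \<omega>' \<bullet> \<epsilon> t (Z (t - 1) \<omega>') \<omega>') \<omega>
          = cond_exp_nn (K (t - 1)) (\<lambda>\<omega>'. \<epsilon> t (Z (t - 1) \<omega>) \<omega>' \<bullet> \<epsilon> t (Z (t - 1) \<omega>) \<omega>') \<omega>"
    and \<epsilon>_square_finite:
      "\<And>t z. t \<ge> 1 \<Longrightarrow> AE \<omega> in M.
        cond_exp_nn (K (t - 1)) (\<lambda>\<omega>'. \<epsilon> t z \<omega>' \<bullet> \<epsilon> t z \<omega>') \<omega> < \<infinity>"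
    and \<epsilon>_square_Z_finite:
      "\<And>t. t \<ge> 1 \<Longrightarrow> AE \<omega> in M.
        cond_exp_nn (K (t - 1)) (\<lambda>\<omega>'. \<epsilon> t (Z (t - 1) \<omega>') \<omega>' \<bullet> \<epsilon> t (Z (t - 1) \<omega>') \<omega>') \<omega> < \<infinity>"
    and \<gamma>_start: "\<gamma> 0 z0 \<in> borel_measurable (F 0)"
    and \<gamma>_invertible: "\<And>t. AE \<omega> in M. invertible (\<gamma> t z0 \<omega>)"

definition rescaled ::
  "(nat \<Rightarrow> real^'m \<Rightarrow> 'a \<Rightarrow> real^'m^'m) \<Rightarrow> real^'m \<Rightarrow> (nat \<Rightarrow> real^'m \<Rightarrow> 'a \<Rightarrow> real^'m) \<Rightarrow>
    nat \<Rightarrow> real^'m \<Rightarrow> 'a \<Rightarrow> real^'m" where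
  "rescaled \<gamma> z0 f s z \<omega> = (matrix_inv (\<gamma> s z0 \<omega>) ** \<gamma> s z \<omega>) *v f s z \<omega>"

end

theory Submission
  imports Defs
begin

text \<open>
  Write \<open>G t\<close> for \<open>\<gamma> t z0\<close> and put \<open>W t = inverse (G t) *v \<Delta> t - (\<Sum>s=1..t. \<epsilon> s z0)\<close>. Factoring
  out \<open>G t\<close> and inserting \<open>A t ** inverse (A t)\<close> gives
  \<open>A t *v (Z t - Zstar t) = (A t ** G t ** A t) *v (inverse (A t) *v W t)\<close> almost surely. The
  first factor converges in probability to a finite limit, so it is bounded in probability, and
  it remains to see that \<open>inverse (A t) *v W t\<close> tends to \<open>0\<close> in probability.

  As long as the recursion runs without truncation, the increment of \<open>W\<close> is, by summation by
  parts, exactly the sum of the summands in the two remaining hypotheses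
  (\<open>summation_by_parts_remainder\<close>). Hence \<open>W = S3 + S4 + C\<close>, where \<open>S3\<close> and \<open>S4\<close> are the sums
  that become negligible after multiplication by \<open>inverse (A t)\<close>, and \<open>C\<close> is constant from a
  random time on: it collects the starting value and the effect of the almost surely finitely many
  truncations. So \<open>C\<close> is almost surely bounded, thus bounded in probability, and
  \<open>inverse (A t)\<close>, which tends to \<open>0\<close>, annihilates it as well.

  Both limit arguments are instances of \<open>tendsto_in_prob_bounded_mult\<close>: a bounded bilinear product
  of a factor bounded in probability and a factor tending to \<open>0\<close> in probability tends to \<open>0\<close> in
  probability.

  Convergence in probability is stated through \<^const>\<open>measure\<close>, which vanishes on non-measurable
  sets, so the hypotheses carry information only once the processes in them are known to be
  measurable. For \<open>Z\<close> this requires the truncation to a random convex set to be measurable when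
  it is applied at a random point (\<open>borel_measurable_Z\<close>).
\<close>

section \<open>Measurability of matrix operations\<close>

lemma bounded_bilinear_matrix_vector:
  "bounded_bilinear ((*v) :: real^'n^'m \<Rightarrow> real^'n \<Rightarrow> real^'m)"
proof -
  have "bilinear ((*v) :: real^'n^'m \<Rightarrow> real^'n \<Rightarrow> real^'m)"
    by (auto simp: bilinear_def matrix_vector_mult_add_rdistrib scaleR_matrix_vector_assoc
        intro!: linearI)
  then show ?thesis by (simp add: bilinear_conv_bounded_bilinear)
qed

lemma bounded_bilinear_matrix_matrix:
  "bounded_bilinear ((**) :: real^'n^'m \<Rightarrow> real^'k^'n \<Rightarrow> real^'k^'m)"
proof -
  have "bilinear ((**) :: real^'n^'m \<Rightarrow> real^'k^'n \<Rightarrow> real^'k^'m)"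
    by (auto simp: bilinear_def matrix_add_ldistrib matrix_matrix_mult_def vec_eq_iff
        sum_distrib_left sum.distrib algebra_simps intro!: linearI)
  then show ?thesis by (simp add: bilinear_conv_bounded_bilinear)
qed

lemma borel_measurable_bounded_bilinear:
  fixes h :: "'b::{real_normed_vector, second_countable_topology} \<Rightarrow>
    'c::{real_normed_vector, second_countable_topology} \<Rightarrow> 'd::real_normed_vector"
  assumes "bounded_bilinear h" "f \<in> borel_measurable M" "g \<in> borel_measurable M"
  shows "(\<lambda>x. h (f x) (g x)) \<in> borel_measurable M"
  by (rule borel_measurable_continuous_Pair[OF assms(2,3)])
     (intro bounded_bilinear.continuous_on[OF assms(1)] continuous_intros)

lemmas borel_measurable_matrix_vector [measurable (raw)] =
  borel_measurable_bounded_bilinear[OF bounded_bilinear_matrix_vector]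

lemmas borel_measurable_matrix_matrix [measurable (raw)] =
  borel_measurable_bounded_bilinear[OF bounded_bilinear_matrix_matrix]

lemma borel_measurable_vecI:
  fixes f :: "'a \<Rightarrow> 'b::euclidean_space^'n"
  assumes "\<And>i. (\<lambda>x. f x $ i) \<in> borel_measurable M"
  shows "f \<in> borel_measurable M"
  unfolding borel_measurable_euclidean_space[of f]
  using assms by (auto simp: Basis_vec_def inner_axis)

lemma borel_measurable_vec_nth:
  fixes f :: "'a \<Rightarrow> 'b::euclidean_space^'n"
  assumes "f \<in> borel_measurable M"
  shows "(\<lambda>x. f x $ i) \<in> borel_measurable M"
  by (rule borel_measurable_continuous_on[OF _ assms]) (intro continuous_intros)

lemma borel_measurable_det:
  fixes A :: "'a \<Rightarrow> real^'n^'n"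
  assumes "\<And>i j. (\<lambda>x. A x $ i $ j) \<in> borel_measurable M"
  shows "(\<lambda>x. det (A x)) \<in> borel_measurable M"
  unfolding det_def using assms by (intro borel_measurable_sum borel_measurable_times
      borel_measurable_prod borel_measurable_const)

lemma matrix_inv_inverse:
  fixes A :: "real^'n^'n"
  assumes "invertible A"
  shows "A ** matrix_inv A = mat 1" "matrix_inv A ** A = mat 1"
  using someI_ex[OF assms[unfolded invertible_def]] by (auto simp: matrix_inv_def)

text \<open>
  Cramer's rule writes the entries of the inverse as quotients of determinants; on the singular
  matrices the choice operator in \<^const>\<open>matrix_inv\<close> ranges over the empty predicate, so its
  value there does not depend on the matrix.
\<close>

lemma borel_measurable_matrix_inv [measurable (raw)]:
  fixes A :: "'a \<Rightarrow> real^'n^'n"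
  assumes A: "A \<in> borel_measurable M"
  shows "(\<lambda>x. matrix_inv (A x)) \<in> borel_measurable M"
proof (rule borel_measurable_vecI, rule borel_measurable_vecI)
  fix k l
  define c where "c = (SOME B :: real^'n^'n. False) $ k $ l"
  define a where "a x = (\<chi> i j. if j = k then (axis l 1 :: real^'n) $ i else A x $ i $ j)" for x
  have entry [measurable]: "(\<lambda>x. A x $ i $ j) \<in> borel_measurable M" for i j
    by (intro borel_measurable_vec_nth A)
  have "(\<lambda>x. a x $ i $ j) \<in> borel_measurable M" for i j
    by (cases "j = k") (simp_all add: a_def)
  then have [measurable]: "(\<lambda>x. det (a x)) \<in> borel_measurable M"
    by (rule borel_measurable_det)
  have [measurable]: "(\<lambda>x. det (A x)) \<in> borel_measurable M"
    by (rule borel_measurable_det) measurable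
  \<comment> \<open>Cramer's rule for the linear system with right-hand side \<open>axis l 1\<close>, whose solution is the
    \<open>l\<close>-th column of the inverse\<close>
  have "matrix_inv (A x) $ k $ l = (if det (A x) = 0 then c else det (a x) / det (A x))" for x
  proof (cases "det (A x) = 0")
    case True
    then have "\<not> (\<exists>B. A x ** B = mat 1 \<and> B ** A x = mat 1)"
      using invertible_det_nz[of "A x"] by (simp add: invertible_def)
    then have "matrix_inv (A x) = (SOME B. False)"
      unfolding matrix_inv_def by (intro arg_cong[where f = Eps]) auto
    then show ?thesis using True by (simp add: c_def)
  next
    case False
    then have "A x *v (matrix_inv (A x) *v axis l 1) = axis l 1"
      using matrix_inv_inverse[of "A x"] by (simp add: invertible_det_nz matrix_vector_mul_assoc)
    then have "(matrix_inv (A x) *v axis l 1) $ k = det (a x) / det (A x)"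
      unfolding cramer[OF False] a_def by simp
    then show ?thesis using False by (simp add: matrix_vector_mult_basis column_def)
  qed
  then show "(\<lambda>x. matrix_inv (A x) $ k $ l) \<in> borel_measurable M" by simp
qed

section \<open>Measurability of the truncated recursion\<close>

text \<open>
  A Caratheodory function (measurable in the sample, continuous in the space variable) may be
  evaluated at a random point: for a simple random point the composition is a finite case
  distinction, and simple functions approximate the general one pointwise.
\<close>

lemma borel_measurable_caratheodory_compose:
  fixes X :: "'a \<Rightarrow> 'b::{metric_space, second_countable_topology}"
    and f :: "'a \<Rightarrow> 'b \<Rightarrow> 'c::metric_space"
  assumes X: "X \<in> borel_measurable M"
    and meas: "\<And>x. (\<lambda>\<omega>. f \<omega> x) \<in> borel_measurable M"
    and cont: "\<And>\<omega>. \<omega> \<in> space M \<Longrightarrow> continuous_on UNIV (f \<omega>)"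
  shows "(\<lambda>\<omega>. f \<omega> (X \<omega>)) \<in> borel_measurable M"
proof -
  obtain S where S: "\<And>i. simple_function M (S i)" "\<And>\<omega>. \<omega> \<in> space M \<Longrightarrow> (\<lambda>i. S i \<omega>) \<longlonglongrightarrow> X \<omega>"
    using borel_measurable_implies_sequence_metric[OF X] by metis
  show ?thesis
  proof (rule borel_measurable_LIMSEQ_metric)
    fix i
    have fin: "finite (S i ` space M)" using S(1)[of i] by (simp add: simple_function_def)
    have "S i \<in> measurable M (count_space (S i ` space M))"
      using S(1)[of i] fin by (simp add: measurable_count_space_eq2 simple_function_def)
    then show "(\<lambda>\<omega>. f \<omega> (S i \<omega>)) \<in> borel_measurable M"
      by (rule measurable_compose_countable'[where f = "\<lambda>x \<omega>. f \<omega> x", OF meas])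
         (rule countable_finite[OF fin])
  next
    fix \<omega> assume "\<omega> \<in> space M"
    then show "(\<lambda>i. f \<omega> (S i \<omega>)) \<longlonglongrightarrow> f \<omega> (X \<omega>)"
      by (intro continuous_on_tendsto_compose[OF cont] S(2)) auto
  qed
qed

lemma truncation_eq_closest_point: "truncation U = closest_point U"
  by (auto simp: truncation_def closest_point_self)

lemma borel_measurable_at_random_point:
  assumes "(\<lambda>(z, \<omega>). f z \<omega>) \<in> borel_measurable (borel \<Otimes>\<^sub>M M)" "X \<in> borel_measurable M"
  shows "(\<lambda>\<omega>. f (X \<omega>) \<omega>) \<in> borel_measurable M"
  using measurable_compose[OF measurable_Pair[OF assms(2) measurable_ident] assms(1)] by simp

lemma (in truncated_sa_setting) borel_measurable_F:
  "f \<in> borel_measurable (F t) \<Longrightarrow> f \<in> borel_measurable M"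
  using measurable_from_subalg[OF subalgebra_F] .

text \<open>
  The projection onto a closed convex set is continuous, so admissibility makes the truncation a
  Caratheodory function; the remaining ingredients of a step are jointly measurable.
\<close>

lemma (in truncated_sa_setting) borel_measurable_Z: "Z t \<in> borel_measurable M"
proof (induction t)
  case 0
  show ?case using borel_measurable_F[OF Zstart] by (simp add: Z_def)
next
  case (Suc t)
  have [measurable]: "Z t \<in> borel_measurable M" by (rule Suc)
  have [measurable]:
    "(\<lambda>\<omega>. R (Suc t) (Z t \<omega>) \<omega>) \<in> borel_measurable M"
    "(\<lambda>\<omega>. \<epsilon> (Suc t) (Z t \<omega>) \<omega>) \<in> borel_measurable M"
    "(\<lambda>\<omega>. \<gamma> (Suc t) (Z t \<omega>) \<omega>) \<in> borel_measurable M"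
    by (rule borel_measurable_at_random_point[OF _ Suc], rule R_joint \<epsilon>_joint \<gamma>_joint, simp)+
  have "(\<lambda>\<omega>. truncation (U (Suc t) \<omega>)
    (Z t \<omega> + \<gamma> (Suc t) (Z t \<omega>) \<omega> *v (R (Suc t) (Z t \<omega>) \<omega> + \<epsilon> (Suc t) (Z t \<omega>) \<omega>)))
      \<in> borel_measurable M"
  proof (rule borel_measurable_caratheodory_compose[where f = "\<lambda>\<omega>. truncation (U (Suc t) \<omega>)"])
    show "(\<lambda>\<omega>. truncation (U (Suc t) \<omega>) z) \<in> borel_measurable M" for z
      using admissible_U by (intro borel_measurable_F[of _ "Suc t"]) (simp add: admissible_def)
    show "continuous_on UNIV (truncation (U (Suc t) \<omega>))" if "\<omega> \<in> space M" for \<omega>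
      using admissible_U that unfolding truncation_eq_closest_point
      by (intro continuous_on_closest_point) (auto simp: admissible_def)
  qed measurable
  then show ?case by (simp add: Z_def Let_def)
qed

lemma (in truncated_sa_setting) borel_measurable_rescaled:
  assumes "(\<lambda>(z, \<omega>). f s z \<omega>) \<in> borel_measurable (borel \<Otimes>\<^sub>M M)"
    and X: "X \<in> borel_measurable M" and s: "s \<ge> 1"
  shows "(\<lambda>\<omega>. rescaled \<gamma> z0 f s (X \<omega>) \<omega>) \<in> borel_measurable M"
proof -
  have [measurable]: "\<gamma> s z0 \<in> borel_measurable M"
    by (rule borel_measurable_F[OF \<gamma>_predictable[OF s]])
  have [measurable]: "(\<lambda>\<omega>. \<gamma> s (X \<omega>) \<omega>) \<in> borel_measurable M"
    by (rule borel_measurable_at_random_point[OF \<gamma>_joint[OF s] X])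
  have [measurable]: "(\<lambda>\<omega>. f s (X \<omega>) \<omega>) \<in> borel_measurable M"
    by (rule borel_measurable_at_random_point[OF assms(1) X])
  show ?thesis unfolding rescaled_def by measurable
qed

section \<open>Convergence and boundedness in probability\<close>

definition bounded_in_prob :: "'a measure \<Rightarrow> (nat \<Rightarrow> 'a \<Rightarrow> 'b::real_normed_vector) \<Rightarrow> bool" where
  "bounded_in_prob M X \<longleftrightarrow>
     (\<forall>\<delta>>0. \<exists>B. \<forall>\<^sub>F t in sequentially. measure M {\<omega> \<in> space M. norm (X t \<omega>) > B} < \<delta>)"

lemma tendsto_in_prob_iff:
  "tendsto_in_prob M X Y \<longleftrightarrow>
     (\<forall>e>0. \<forall>\<delta>>0. \<forall>\<^sub>F t in sequentially. measure M {\<omega> \<in> space M. norm (X t \<omega> - Y \<omega>) > e} < \<delta>)"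
  by (simp add: tendsto_in_prob_def tendsto_iff)

lemma tendsto_in_probD:
  assumes "tendsto_in_prob M X Y" "e > 0" "\<delta> > 0"
  shows "\<forall>\<^sub>F t in sequentially. measure M {\<omega> \<in> space M. norm (X t \<omega> - Y \<omega>) > e} < \<delta>"
  using assms unfolding tendsto_in_prob_iff by blast

lemmas tendsto_in_prob_0D = tendsto_in_probD[where Y = "\<lambda>_. 0", unfolded diff_zero]

context finite_measure
begin

text \<open>
  The events that some term exceeds the level \<open>n\<close> decrease to a null set, so by continuity from above
  one level serves all \<open>t\<close> simultaneously.
\<close>

lemma bounded_in_prob_of_AE_Bseq:
  fixes X :: "nat \<Rightarrow> 'a \<Rightarrow> 'b::real_normed_vector"
  assumes [measurable]: "\<And>t. X t \<in> borel_measurable M"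
    and bdd: "AE \<omega> in M. Bseq (\<lambda>t. X t \<omega>)"
  shows "bounded_in_prob M X"
proof -
  define D where "D n = {\<omega> \<in> space M. \<exists>t. norm (X t \<omega>) > real n}" for n :: nat
  have D [measurable]: "D n \<in> sets M" for n unfolding D_def by measurable
  have "AE \<omega> in M. \<omega> \<notin> (\<Inter>n. D n)"
    using bdd
  proof eventually_elim
    case (elim \<omega>)
    then obtain b where b: "\<And>t. norm (X t \<omega>) \<le> b" by (auto simp: Bseq_def)
    obtain n where "b < real n" using reals_Archimedean2 by blast
    then have "\<omega> \<notin> D n" unfolding D_def using b by (auto simp: not_less intro: order_trans less_imp_le)
    then show ?case by blast
  qed
  then have "measure M (\<Inter>n. D n) = 0"
    by (intro measure_eq_0_null_sets) (auto simp: AE_iff_null_sets)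
  moreover have "decseq D"
    unfolding decseq_def D_def by (blast intro: le_less_trans[OF of_nat_mono])
  then have "(\<lambda>n. measure M (D n)) \<longlonglongrightarrow> measure M (\<Inter>n. D n)"
    by (intro finite_Lim_measure_decseq) auto
  ultimately have lim: "(\<lambda>n. measure M (D n)) \<longlonglongrightarrow> 0" by simp
  show ?thesis unfolding bounded_in_prob_def
  proof (intro allI impI)
    fix \<delta> :: real assume "\<delta> > 0"
    then obtain n where "measure M (D n) < \<delta>"
      using order_tendstoD(2)[OF lim] by (auto simp: eventually_sequentially)
    moreover have "measure M {\<omega> \<in> space M. norm (X t \<omega>) > real n} \<le> measure M (D n)" for t
      by (rule finite_measure_mono) (auto simp: D_def)
    ultimately show "\<exists>B. \<forall>\<^sub>F t in sequentially. measure M {\<omega> \<in> space M. norm (X t \<omega>) > B} < \<delta>"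
      by (intro exI[of _ "real n"] always_eventually allI) (rule le_less_trans)
  qed
qed

text \<open>
  The event \<open>P\<close> may be non-measurable: it is only compared from above. This is what the limit
  theorems below use to split an exceedance event into two.
\<close>

lemma measure_Collect_less_add:
  assumes [measurable]: "{\<omega> \<in> space M. Q \<omega>} \<in> sets M" "{\<omega> \<in> space M. R \<omega>} \<in> sets M"
    and "AE \<omega> in M. P \<omega> \<longrightarrow> Q \<omega> \<or> R \<omega>"
    and "measure M {\<omega> \<in> space M. Q \<omega>} < a / 2" "measure M {\<omega> \<in> space M. R \<omega>} < a / 2"
  shows "measure M {\<omega> \<in> space M. P \<omega>} < a"
proof -
  have "measure M {\<omega> \<in> space M. P \<omega>}
      \<le> measure M ({\<omega> \<in> space M. Q \<omega>} \<union> {\<omega> \<in> space M. R \<omega>})"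
    using assms(3) by (intro finite_measure_mono_AE) (auto elim!: eventually_mono)
  also have "\<dots> \<le> measure M {\<omega> \<in> space M. Q \<omega>} + measure M {\<omega> \<in> space M. R \<omega>}"
    by (rule measure_Un_le) measurable
  finally show ?thesis using assms(4,5) by simp
qed

lemma bounded_in_prob_of_tendsto:
  fixes X :: "nat \<Rightarrow> 'a \<Rightarrow> 'b::{real_normed_vector, second_countable_topology}"
  assumes lim: "tendsto_in_prob M X Y"
    and X: "\<forall>\<^sub>F t in sequentially. X t \<in> borel_measurable M"
    and Y [measurable]: "Y \<in> borel_measurable M"
  shows "bounded_in_prob M X"
  unfolding bounded_in_prob_def
proof (intro allI impI)
  fix \<delta> :: real assume \<delta>: "\<delta> > 0"
  have "bounded_in_prob M (\<lambda>t. Y)"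
    by (rule bounded_in_prob_of_AE_Bseq) (simp_all add: Bfun_const)
  then obtain B where "\<forall>\<^sub>F t :: nat in sequentially. measure M {\<omega> \<in> space M. norm (Y \<omega>) > B} < \<delta> / 2"
    unfolding bounded_in_prob_def using half_gt_zero[OF \<delta>] by blast
  then have B: "measure M {\<omega> \<in> space M. norm (Y \<omega>) > B} < \<delta> / 2" by simp
  have "\<forall>\<^sub>F t in sequentially. measure M {\<omega> \<in> space M. norm (X t \<omega> - Y \<omega>) > 1} < \<delta> / 2"
    by (rule tendsto_in_probD[OF lim zero_less_one half_gt_zero[OF \<delta>]])
  with X have "\<forall>\<^sub>F t in sequentially. measure M {\<omega> \<in> space M. norm (X t \<omega>) > B + 1} < \<delta>"
  proof eventually_elim
    case (elim t)
    note [measurable] = elim(1)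
    have "norm (X t \<omega> - Y \<omega>) > 1 \<or> norm (Y \<omega>) > B" if "norm (X t \<omega>) > B + 1" for \<omega>
      using that norm_triangle_sub[of "X t \<omega>" "Y \<omega>"] by linarith
    then show ?case by (intro measure_Collect_less_add[OF _ _ _ elim(2) B]) auto
  qed
  then show "\<exists>B. \<forall>\<^sub>F t in sequentially. measure M {\<omega> \<in> space M. norm (X t \<omega>) > B} < \<delta>" ..
qed

text \<open>
  Where \<open>norm x \<le> B\<close>, the product exceeds \<open>e\<close> only if \<open>norm y\<close> exceeds a fixed multiple of \<open>e\<close>.
\<close>

lemma tendsto_in_prob_bounded_mult:
  fixes X :: "nat \<Rightarrow> 'a \<Rightarrow> 'b::{real_normed_vector, second_countable_topology}"
    and Y :: "nat \<Rightarrow> 'a \<Rightarrow> 'c::{real_normed_vector, second_countable_topology}"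
    and h :: "'b \<Rightarrow> 'c \<Rightarrow> 'd::real_normed_vector"
  assumes h: "bounded_bilinear h"
    and bdd: "bounded_in_prob M X" and lim: "tendsto_in_prob M Y (\<lambda>_. 0)"
    and X: "\<forall>\<^sub>F t in sequentially. X t \<in> borel_measurable M"
    and Y: "\<forall>\<^sub>F t in sequentially. Y t \<in> borel_measurable M"
  shows "tendsto_in_prob M (\<lambda>t \<omega>. h (X t \<omega>) (Y t \<omega>)) (\<lambda>_. 0)"
  unfolding tendsto_in_prob_iff
proof (intro allI impI)
  fix e \<delta> :: real assume e: "e > 0" and \<delta>: "\<delta> > 0"
  obtain k where k: "k > 0" "\<And>x y. norm (h x y) \<le> norm x * norm y * k"
    using bounded_bilinear.pos_bounded[OF h] by blast
  obtain B where B: "\<forall>\<^sub>F t in sequentially. measure M {\<omega> \<in> space M. norm (X t \<omega>) > B} < \<delta> / 2"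
    using bdd \<delta> unfolding bounded_in_prob_def by (meson half_gt_zero)
  \<comment> \<open>the maximum with \<open>1\<close> only guarantees a positive divisor, since \<open>B\<close> may be negative or zero\<close>
  define e' where "e' = e / (max B 1 * k)"
  have e': "e' > 0" "max B 1 * e' * k = e" using e k by (auto simp: e'_def)
  have "\<forall>\<^sub>F t in sequentially. measure M {\<omega> \<in> space M. norm (Y t \<omega>) > e'} < \<delta> / 2"
    by (rule tendsto_in_prob_0D[OF lim e'(1) half_gt_zero[OF \<delta>]])
  with B X Y
  show "\<forall>\<^sub>F t in sequentially. measure M {\<omega> \<in> space M. norm (h (X t \<omega>) (Y t \<omega>) - 0) > e} < \<delta>"
  proof eventually_elim
    case (elim t)
    note [measurable] = elim(2,3)
    have "norm (X t \<omega>) > B \<or> norm (Y t \<omega>) > e'" if "norm (h (X t \<omega>) (Y t \<omega>) - 0) > e" for \<omega>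
    proof (rule ccontr)
      assume "\<not> ?thesis"
      then have "norm (X t \<omega>) * norm (Y t \<omega>) * k \<le> max B 1 * e' * k"
        using k by (intro mult_right_mono mult_mono) auto
      then show False using that k(2)[of "X t \<omega>" "Y t \<omega>"] e' by simp
    qed
    then show ?case by (intro measure_Collect_less_add[OF _ _ _ elim(1,4)]) auto
  qed
qed

lemma tendsto_in_prob_add_0:
  fixes X Y :: "nat \<Rightarrow> 'a \<Rightarrow> 'b::{real_normed_vector, second_countable_topology}"
  assumes limX: "tendsto_in_prob M X (\<lambda>_. 0)" and limY: "tendsto_in_prob M Y (\<lambda>_. 0)"
    and X: "\<forall>\<^sub>F t in sequentially. X t \<in> borel_measurable M"
    and Y: "\<forall>\<^sub>F t in sequentially. Y t \<in> borel_measurable M"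
  shows "tendsto_in_prob M (\<lambda>t \<omega>. X t \<omega> + Y t \<omega>) (\<lambda>_. 0)"
  unfolding tendsto_in_prob_iff
proof (intro allI impI)
  fix e \<delta> :: real assume e: "e > 0" and \<delta>: "\<delta> > 0"
  have "\<forall>\<^sub>F t in sequentially. measure M {\<omega> \<in> space M. norm (X t \<omega>) > e / 2} < \<delta> / 2"
    "\<forall>\<^sub>F t in sequentially. measure M {\<omega> \<in> space M. norm (Y t \<omega>) > e / 2} < \<delta> / 2"
    using tendsto_in_prob_0D[OF limX] tendsto_in_prob_0D[OF limY] half_gt_zero[OF e] half_gt_zero[OF \<delta>]
    by blast+
  with X Y
  show "\<forall>\<^sub>F t in sequentially. measure M {\<omega> \<in> space M. norm (X t \<omega> + Y t \<omega> - 0) > e} < \<delta>"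
  proof eventually_elim
    case (elim t)
    note [measurable] = elim(1,2)
    have "norm (X t \<omega>) > e / 2 \<or> norm (Y t \<omega>) > e / 2" if "norm (X t \<omega> + Y t \<omega> - 0) > e" for \<omega>
      using that norm_triangle_ineq[of "X t \<omega>" "Y t \<omega>"] unfolding diff_zero by linarith
    then show ?case by (intro measure_Collect_less_add[OF _ _ _ elim(3,4)]) auto
  qed
qed

lemma tendsto_in_prob_cong_AE:
  fixes X Y :: "nat \<Rightarrow> 'a \<Rightarrow> 'b::{real_normed_vector, second_countable_topology}"
  assumes lim: "tendsto_in_prob M X L"
    and X: "\<forall>\<^sub>F t in sequentially. X t \<in> borel_measurable M"
    and L [measurable]: "L \<in> borel_measurable M"
    and eq: "\<forall>\<^sub>F t in sequentially. AE \<omega> in M. Y t \<omega> = X t \<omega>"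
  shows "tendsto_in_prob M Y L"
  unfolding tendsto_in_prob_iff
proof (intro allI impI)
  fix e \<delta> :: real assume e: "e > 0" and \<delta>: "\<delta> > 0"
  have "\<forall>\<^sub>F t in sequentially. measure M {\<omega> \<in> space M. norm (X t \<omega> - L \<omega>) > e} < \<delta>"
    by (rule tendsto_in_probD[OF lim e \<delta>])
  with X eq show "\<forall>\<^sub>F t in sequentially. measure M {\<omega> \<in> space M. norm (Y t \<omega> - L \<omega>) > e} < \<delta>"
  proof eventually_elim
    case (elim t)
    note [measurable] = elim(1)
    have "measure M {\<omega> \<in> space M. norm (Y t \<omega> - L \<omega>) > e}
        \<le> measure M {\<omega> \<in> space M. norm (X t \<omega> - L \<omega>) > e}"
      using elim(2) by (intro finite_measure_mono_AE) (auto elim!: eventually_mono)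
    then show ?case using elim(3) by simp
  qed
qed

end

section \<open>Summation by parts and the limit\<close>

text \<open>
  Here \<open>H s\<close> plays the inverse of \<open>\<gamma> s z0\<close>, \<open>d\<close> the deviation from \<open>z0\<close> and \<open>G\<close> the step matrix, with
  drift \<open>r\<close> and noise \<open>e\<close>. The increment \<open>H t *v d t - H (t - 1) *v d (t - 1)\<close> splits into
  \<open>(H t - H (t - 1)) *v d (t - 1)\<close> and \<open>H t *v (d t - d (t - 1))\<close>; an untruncated step turns the
  latter into \<open>(H t ** G t) *v r t + (H t ** G t) *v e t\<close>, and the sums cancel it.
\<close>

lemma summation_by_parts_remainder:
  fixes H :: "nat \<Rightarrow> real^'n^'m" and G :: "nat \<Rightarrow> real^'k^'n"
    and d :: "nat \<Rightarrow> real^'n" and r e :: "nat \<Rightarrow> real^'k" and e0 :: "nat \<Rightarrow> real^'m"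
  defines "C \<equiv> \<lambda>t. H t *v d t - (\<Sum>s=1..t. e0 s)
      - (\<Sum>s=1..t. (H s - H (s - 1)) *v d (s - 1) + (H s ** G s) *v r s)
      - (\<Sum>s=1..t. (H s ** G s) *v e s - e0 s)"
  assumes "d (Suc t) = d t + G (Suc t) *v (r (Suc t) + e (Suc t))"
  shows "C (Suc t) = C t"
  using assms(2) unfolding C_def
  by (simp add: matrix_vector_mult_diff_rdistrib matrix_vector_mul_assoc[symmetric]
      matrix_vector_right_distrib algebra_simps)

lemma Bseq_of_eventually_constant:
  fixes c :: "nat \<Rightarrow> 'b::real_normed_vector"
  assumes "\<forall>\<^sub>F t in sequentially. c (Suc t) = c t"
  shows "Bseq c"
proof -
  obtain N where N: "\<And>t. t \<ge> N \<Longrightarrow> c (Suc t) = c t"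
    using assms by (auto simp: eventually_sequentially)
  have "c t = c N" if "t \<ge> N" for t
    using that by (induction t rule: dec_induct) (simp, metis N)
  then have "\<forall>\<^sub>F t in sequentially. c t = c N"
    unfolding eventually_sequentially by blast
  then have "c \<longlonglongrightarrow> c N" by (rule tendsto_eventually)
  then show ?thesis by (rule convergent_imp_Bseq[OF convergentI])
qed

theorem theorem2p4:
  fixes M M0 :: "'a measure"
    and F :: "nat \<Rightarrow> 'a measure"
    and K :: "nat \<Rightarrow> 'a \<Rightarrow> 'a measure"
    and R \<epsilon> :: "nat \<Rightarrow> real^'m \<Rightarrow> 'a \<Rightarrow> real^'m"
    and \<gamma> :: "nat \<Rightarrow> real^'m \<Rightarrow> 'a \<Rightarrow> real^'m^'m"
    and U :: "nat \<Rightarrow> 'a \<Rightarrow> (real^'m) set"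
    and z0 :: "real^'m"
    and Zstart :: "'a \<Rightarrow> real^'m"
    and Z \<Delta> Zstar :: "nat \<Rightarrow> 'a \<Rightarrow> real^'m"
    and A :: "nat \<Rightarrow> 'a \<Rightarrow> real^'m^'m"
    and \<eta> :: "'a \<Rightarrow> real^'m^'m"
  assumes setting: "truncated_sa_setting M F M0 K R \<epsilon> \<gamma> U z0 Zstart Z"
    and \<Delta>: "\<And>t \<omega>. \<Delta> t \<omega> = Z t \<omega> - z0"
    and Zstar: "\<And>t \<omega>. Zstar t \<omega> = z0 + \<gamma> t z0 \<omega> *v (\<Sum>s=1..t. \<epsilon> s z0 \<omega>)"
    and E1: "eventually_as M
      (\<lambda>t \<omega>. Z t \<omega> = Z (t - 1) \<omega> +
        \<gamma> t (Z (t - 1) \<omega>) \<omega> *v (R t (Z (t - 1) \<omega>) \<omega> + \<epsilon> t (Z (t - 1) \<omega>) \<omega>))"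
    and A_measurable: "\<And>t. t \<ge> 1 \<Longrightarrow> A t \<in> borel_measurable M"
    and A_invertible: "\<And>t. t \<ge> 1 \<Longrightarrow> AE \<omega> in M. invertible (A t \<omega>)"
    and \<eta>_measurable: "\<eta> \<in> borel_measurable M"
    and E2_inverse: "tendsto_in_prob M (\<lambda>t \<omega>. matrix_inv (A t \<omega>)) (\<lambda>_. 0)"
    and E2_limit: "tendsto_in_prob M (\<lambda>t \<omega>. A t \<omega> ** \<gamma> t z0 \<omega> ** A t \<omega>) \<eta>"
    and E3: "tendsto_in_prob M
      (\<lambda>t \<omega>. matrix_inv (A t \<omega>) *v
        (\<Sum>s=1..t. (matrix_inv (\<gamma> s z0 \<omega>) - matrix_inv (\<gamma> (s - 1) z0 \<omega>)) *v \<Delta> (s - 1) \<omega>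
                     + rescaled \<gamma> z0 R s (z0 + \<Delta> (s - 1) \<omega>) \<omega>)) (\<lambda>_. 0)"
    and E4: "tendsto_in_prob M
      (\<lambda>t \<omega>. matrix_inv (A t \<omega>) *v
        (\<Sum>s=1..t. rescaled \<gamma> z0 \<epsilon> s (z0 + \<Delta> (s - 1) \<omega>) \<omega> - \<epsilon> s z0 \<omega>)) (\<lambda>_. 0)"
  shows "tendsto_in_prob M (\<lambda>t \<omega>. A t \<omega> *v (Z t \<omega> - Zstar t \<omega>)) (\<lambda>_. 0) \<and>
         locally_asymp_linear M A Z z0 (\<lambda>t. \<gamma> t z0) (\<lambda>t. \<epsilon> t z0)"
proof -
  interpret truncated_sa_setting M F M0 K R \<epsilon> \<gamma> U z0 Zstart Z by (fact setting)
  define S3 where "S3 t \<omega> =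
    (\<Sum>s=1..t. (matrix_inv (\<gamma> s z0 \<omega>) - matrix_inv (\<gamma> (s - 1) z0 \<omega>)) *v \<Delta> (s - 1) \<omega>
       + rescaled \<gamma> z0 R s (z0 + \<Delta> (s - 1) \<omega>) \<omega>)" for t \<omega>
  define S4 where "S4 t \<omega> =
    (\<Sum>s=1..t. rescaled \<gamma> z0 \<epsilon> s (z0 + \<Delta> (s - 1) \<omega>) \<omega> - \<epsilon> s z0 \<omega>)" for t \<omega>
  define W where "W t \<omega> = matrix_inv (\<gamma> t z0 \<omega>) *v \<Delta> t \<omega> - (\<Sum>s=1..t. \<epsilon> s z0 \<omega>)" for t \<omega>
  define C where "C t \<omega> = W t \<omega> - S3 t \<omega> - S4 t \<omega>" for t \<omega>
  define V where "V t \<omega> = (A t \<omega> ** \<gamma> t z0 \<omega> ** A t \<omega>) *v (matrix_inv (A t \<omega>) *v W t \<omega>)" for t \<omega>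

  have \<gamma>m [measurable]: "\<gamma> t z0 \<in> borel_measurable M" for t
    using \<gamma>_start \<gamma>_predictable[of t z0] by (cases t) (auto intro: borel_measurable_F)
  have \<epsilon>m: "\<epsilon> s z0 \<in> borel_measurable M" if "s \<ge> 1" for s
    using \<epsilon>_adapted[OF that] by (rule borel_measurable_F)
  have [measurable]: "Z t \<in> borel_measurable M" for t by (rule borel_measurable_Z)
  have \<Delta>m [measurable]: "\<Delta> t \<in> borel_measurable M" for t
    unfolding \<Delta>[abs_def] by measurable
  have Rm: "(\<lambda>\<omega>. rescaled \<gamma> z0 R s (z0 + \<Delta> (s - 1) \<omega>) \<omega>) \<in> borel_measurable M" if "s \<ge> 1" for s
    by (intro borel_measurable_rescaled[OF R_joint] that) measurable
  have em: "(\<lambda>\<omega>. rescaled \<gamma> z0 \<epsilon> s (z0 + \<Delta> (s - 1) \<omega>) \<omega>) \<in> borel_measurable M" if "s \<ge> 1" for s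
    by (intro borel_measurable_rescaled[OF \<epsilon>_joint] that) measurable
  have S3m [measurable]: "S3 t \<in> borel_measurable M" for t
    unfolding S3_def[abs_def]
    by (intro borel_measurable_sum borel_measurable_add Rm) (simp_all, measurable)
  have S4m [measurable]: "S4 t \<in> borel_measurable M" for t
    unfolding S4_def[abs_def] by (intro borel_measurable_sum borel_measurable_diff em \<epsilon>m) simp_all
  have "(\<lambda>\<omega>. \<Sum>s=1..t. \<epsilon> s z0 \<omega>) \<in> borel_measurable M" for t
    by (intro borel_measurable_sum \<epsilon>m) simp
  then have Wm [measurable]: "W t \<in> borel_measurable M" for t
    unfolding W_def[abs_def] by measurable
  have Cm [measurable]: "C t \<in> borel_measurable M" for t
    unfolding C_def[abs_def] by measurable
  have late: "\<forall>\<^sub>F t in sequentially. A t \<in> borel_measurable M"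
    using A_measurable by (auto simp: eventually_sequentially)
  have AIm: "\<forall>\<^sub>F t in sequentially. (\<lambda>\<omega>. matrix_inv (A t \<omega>)) \<in> borel_measurable M"
    using late by eventually_elim measurable
  have AvM: "\<forall>\<^sub>F t in sequentially. (\<lambda>\<omega>. matrix_inv (A t \<omega>) *v f t \<omega>) \<in> borel_measurable M"
    if "\<And>t. f t \<in> borel_measurable M" for f :: "nat \<Rightarrow> 'a \<Rightarrow> real^'m"
    using AIm by eventually_elim (intro borel_measurable_matrix_vector that)
  have AGAm: "\<forall>\<^sub>F t in sequentially. (\<lambda>\<omega>. A t \<omega> ** \<gamma> t z0 \<omega> ** A t \<omega>) \<in> borel_measurable M"
    using late by eventually_elim (intro borel_measurable_matrix_matrix \<gamma>m)

  \<comment> \<open>no further truncation means no further change of the remainder \<open>C\<close>\<close>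
  have "AE \<omega> in M. Bseq (\<lambda>t. C t \<omega>)"
    using E1 unfolding eventually_as_def
  proof eventually_elim
    case (elim \<omega>)
    then have "\<forall>\<^sub>F t in sequentially. Z (Suc t) \<omega> = Z t \<omega> +
        \<gamma> (Suc t) (Z t \<omega>) \<omega> *v (R (Suc t) (Z t \<omega>) \<omega> + \<epsilon> (Suc t) (Z t \<omega>) \<omega>)"
      by (subst (asm) eventually_sequentially_Suc[symmetric]) simp
    then have "\<forall>\<^sub>F t in sequentially. C (Suc t) \<omega> = C t \<omega>"
    proof eventually_elim
      case (elim t)
      show ?case
        unfolding C_def W_def S3_def S4_def rescaled_def
        by (rule summation_by_parts_remainder[where H = "\<lambda>s. matrix_inv (\<gamma> s z0 \<omega>)" and
              d = "\<lambda>s. \<Delta> s \<omega>" and G = "\<lambda>s. \<gamma> s (z0 + \<Delta> (s - 1) \<omega>) \<omega>"])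
           (simp add: \<Delta> elim)
    qed
    then show ?case by (rule Bseq_of_eventually_constant)
  qed
  then have "bounded_in_prob M C"
    by (rule bounded_in_prob_of_AE_Bseq[OF Cm])
  then have limC: "tendsto_in_prob M (\<lambda>t \<omega>. matrix_inv (A t \<omega>) *v C t \<omega>) (\<lambda>_. 0)"
    by (rule tendsto_in_prob_bounded_mult
          [OF bounded_bilinear.flip[OF bounded_bilinear_matrix_vector] _ E2_inverse])
       (simp_all add: AIm Cm)
  have "tendsto_in_prob M (\<lambda>t \<omega>. matrix_inv (A t \<omega>) *v C t \<omega> +
      (matrix_inv (A t \<omega>) *v S3 t \<omega> + matrix_inv (A t \<omega>) *v S4 t \<omega>)) (\<lambda>_. 0)"
    using E3 E4 unfolding S3_def[symmetric] S4_def[symmetric]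
    by (intro tendsto_in_prob_add_0 limC AvM Cm S3m S4m eventually_mono[OF
          eventually_conj[OF AvM[OF S3m] AvM[OF S4m]]] borel_measurable_add) auto
  also have "(\<lambda>t \<omega>. matrix_inv (A t \<omega>) *v C t \<omega> +
      (matrix_inv (A t \<omega>) *v S3 t \<omega> + matrix_inv (A t \<omega>) *v S4 t \<omega>)) =
      (\<lambda>t \<omega>. matrix_inv (A t \<omega>) *v W t \<omega>)"
    by (simp add: C_def matrix_vector_right_distrib[symmetric])
  finally have limW: "tendsto_in_prob M (\<lambda>t \<omega>. matrix_inv (A t \<omega>) *v W t \<omega>) (\<lambda>_. 0)" .

  have limV: "tendsto_in_prob M V (\<lambda>_. 0)"
    unfolding V_def[abs_def]
    by (rule tendsto_in_prob_bounded_mult[OF bounded_bilinear_matrix_vector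
          bounded_in_prob_of_tendsto[OF E2_limit AGAm \<eta>_measurable] limW AGAm AvM[OF Wm]])
  have Vm: "\<forall>\<^sub>F t in sequentially. V t \<in> borel_measurable M"
    unfolding V_def[abs_def] using AGAm AvM[OF Wm]
    by eventually_elim (rule borel_measurable_matrix_vector)
  have "AE \<omega> in M. A t \<omega> *v (Z t \<omega> - Zstar t \<omega>) = V t \<omega>" if "t \<ge> 1" for t
    using A_invertible[OF that] \<gamma>_invertible[of t]
  proof eventually_elim
    case (elim \<omega>)
    have "V t \<omega> = A t \<omega> *v (\<gamma> t z0 \<omega> *v ((A t \<omega> ** matrix_inv (A t \<omega>)) *v W t \<omega>))"
      by (simp add: V_def matrix_vector_mul_assoc matrix_mul_assoc)
    also have "\<dots> = A t \<omega> *v (\<gamma> t z0 \<omega> *v W t \<omega>)"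
      by (simp add: matrix_inv_inverse[OF elim(1)])
    also have "\<gamma> t z0 \<omega> *v W t \<omega> = Z t \<omega> - Zstar t \<omega>"
      by (simp add: W_def Zstar \<Delta> matrix_vector_mult_diff_distrib matrix_vector_mul_assoc
          matrix_inv_inverse[OF elim(2)])
    finally show ?case by simp
  qed
  then have "\<forall>\<^sub>F t in sequentially. AE \<omega> in M. A t \<omega> *v (Z t \<omega> - Zstar t \<omega>) = V t \<omega>"
    by (auto simp: eventually_sequentially)
  then have lim: "tendsto_in_prob M (\<lambda>t \<omega>. A t \<omega> *v (Z t \<omega> - Zstar t \<omega>)) (\<lambda>_. 0)"
    by (intro tendsto_in_prob_cong_AE[OF limV Vm]) simp_all
  moreover have "locally_asymp_linear M A Z z0 (\<lambda>t. \<gamma> t z0) (\<lambda>t. \<epsilon> t z0)"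
    using lim unfolding locally_asymp_linear_def Zstar by (simp add: diff_diff_add)
  ultimately show ?thesis ..
qed

end
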